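(* Let $M=(M_n)_{n\in\mathbb{N}}$ be a discrete-time normal martingale with the chaotic representation property. Let $F$ be a (complex-valued) function on $\Gamma$. If $F$ satisfies that for each $p\ge0$ there exists $C\ge0$ such that $$|F(\sigma)|\le C\lambda_\sigma^{-p},\quad \sigma\in\Gamma, \qquad ( * )$$ then there exists a unique $\eta\in\mathcal{S}(M)$ such that $\widehat{\Phi_\eta}=F$. Conversely, if $F=\widehat{\Phi_\eta}$ for some $\eta\in\mathcal{S}(M)$, then for each $p\ge0$ there exists $C\ge0$ such that $( * )$ holds. Here $\Phi_\eta\in\mathcal{S}^*(M)$ is the functional $\Phi_\eta(\xi)=\langle\eta,\xi\rangle$ and $\widehat{\cdot}$ denotes the Fock transform.
   Context: $\mathbb{N}$ is the set of nonnegative integers and $\Gamma$ is the (countably infinite) set of all finite subsets of $\mathbb{N}$. $(\Omega,\mathcal{F},P)$ is a probability space; $\langle\cdot,\cdot\rangle$ and $\|\cdot\|$ are the inner product (conjugate-linear in the first argument, linear in the second) and norm of the Hilbert space $\mathcal{L}^2(\Omega,\mathcal{F},P)$ of complex-valued square integrable functions. A real-valued square integrable process $M=(M_n)_{n\in\mathbb{N}}$ on $(\Omega,\mathcal{F},P)$ is a discrete-time normal martingale if, with $\mathcal{F}_{-1}=\{\emptyset,\Omega\}$ and $\mathcal{F}_n=\sigma(M_k;0\le k\le n)$: (i) $\mathbb{E}[M_0|\mathcal{F}_{-1}]=0$ and $\mathbb{E}[M_n|\mathcal{F}_{n-1}]=M_{n-1}$ for $n\ge1$; (ii) $\mathbb{E}[M_0^2|\mathcal{F}_{-1}]=1$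 and $\mathbb{E}[M_n^2|\mathcal{F}_{n-1}]=M_{n-1}^2+1$ for $n\ge1$. Put $Z_0=M_0$, $Z_n=M_n-M_{n-1}$ for $n\ge1$, $Z_\emptyset=1$, and $Z_\sigma=\prod_{i\in\sigma}Z_i$ for nonempty $\sigma\in\Gamma$; $\{Z_\sigma\mid\sigma\in\Gamma\}$ is an orthonormal system in $\mathcal{L}^2(\Omega,\mathcal{F},P)$. Let $\mathcal{F}_\infty=\sigma(M_n;n\in\mathbb{N})$ and $\mathcal{L}^2(M)=\mathcal{L}^2(\Omega,\mathcal{F}_\infty,P)$. $M$ has the chaotic representation property if $\{Z_\sigma\mid\sigma\in\Gamma\}$ is total in $\mathcal{L}^2(M)$ (hence an orthonormal basis of it). Let $\lambda_\emptyset=1$ and $\lambda_\sigma=\prod_{k\in\sigma}(k+1)$ for nonempty $\sigma\in\Gamma$. For $p\ge0$ put $\|\xi\|_p^2=\sum_{\sigma\in\Gamma}\lambda_\sigma^{2p}|\langle Z_\sigma,\xi\rangle|^2$ for $\xi\in\mathcal{L}^2(M)$, and $\mathcal{S}_p(M)=\{\xi\in\mathcal{L}^2(M)\mid\|\xi\|_p<\infty\}$, a Hilbert space with norm $\|\cdot\|_p$. Let $\mathcal{S}(M)=\bigcap_{p=0}^\infty\mathcal{S}_p(M)$ with the topology generated by the norms $\{\|\cdot\|_p\}_{p\ge0}$; all $Z_\sigma$ belong to $\mathcal{S}(M)$. Elements of $\mathcal{S}(M)$ are called testing functionals of $M$. $\mathcal{S}^*(M)$ is the dual of $\mathcal{S}(M)$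 (continuous linear functionals); its elements are called generalized functionals of $M$. The Fock transform of $\Phi\in\mathcal{S}^*(M)$ is the function $\widehat{\Phi}$ on $\Gamma$ given by $\widehat{\Phi}(\sigma)=\Phi(Z_\sigma)$, $\sigma\in\Gamma$. For $\eta\in\mathcal{S}(M)$, $\Phi_\eta$ is the continuous linear functional on $\mathcal{L}^2(M)$ given by $\Phi_\eta(\xi)=\langle\eta,\xi\rangle$; its restriction to $\mathcal{S}(M)$ is continuous in the topology of $\mathcal{S}(M)$, so $\Phi_\eta$ is regarded as an element of $\mathcal{S}^*(M)$. *)

theory Defs
  imports "HOL-Probability.Probability" "HOL-Library.FSet"
begin

text \<open>
  The index set of all finite subsets of the natural numbers is the type \<open>nat fset\<close>.
  Throughout, \<open>P\<close> is the probability measure and \<open>M\<close> the process. Elements of \<open>L\<^sup>2\<close> are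
  represented by functions, so equality in \<open>L\<^sup>2\<close> is almost sure equality.
\<close>

subsection \<open>Discrete-time normal martingales\<close>

definition sigma_of :: "'a measure \<Rightarrow> (nat \<Rightarrow> 'a \<Rightarrow> real) \<Rightarrow> nat set \<Rightarrow> 'a measure" where
  "sigma_of P M K = sigma (space P) (\<Union>k\<in>K. {M k -` B \<inter> space P | B. B \<in> sets borel})"

text \<open>
  The sigma-algebra at time \<open>n\<close> is \<open>sigma_of P M {..n}\<close>, the one at infinity is
  \<open>sigma_of P M UNIV\<close>, and \<open>sigma_of P M {}\<close> is the trivial one (time \<open>-1\<close>).
\<close>

definition normal_martingale :: "'a measure \<Rightarrow> (nat \<Rightarrow> 'a \<Rightarrow> real) \<Rightarrow> bool" where
  "normal_martingale P M \<longleftrightarrow>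
     (\<forall>n. M n \<in> borel_measurable P \<and> integrable P (\<lambda>\<omega>. (M n \<omega>)\<^sup>2)) \<and>
     (AE \<omega> in P. real_cond_exp P (sigma_of P M {}) (M 0) \<omega> = 0) \<and>
     (\<forall>n. AE \<omega> in P. real_cond_exp P (sigma_of P M {..n}) (M (Suc n)) \<omega> = M n \<omega>) \<and>
     (AE \<omega> in P. real_cond_exp P (sigma_of P M {}) (\<lambda>\<omega>. (M 0 \<omega>)\<^sup>2) \<omega> = 1) \<and>
     (\<forall>n. AE \<omega> in P. real_cond_exp P (sigma_of P M {..n}) (\<lambda>\<omega>. (M (Suc n) \<omega>)\<^sup>2) \<omega>
            = (M n \<omega>)\<^sup>2 + 1)"

definition increment :: "(nat \<Rightarrow> 'a \<Rightarrow> real) \<Rightarrow> nat \<Rightarrow> 'a \<Rightarrow> real" where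
  "increment M n \<omega> = (if n = 0 then M 0 \<omega> else M n \<omega> - M (n - 1) \<omega>)"

definition Z :: "(nat \<Rightarrow> 'a \<Rightarrow> real) \<Rightarrow> nat fset \<Rightarrow> 'a \<Rightarrow> complex" where
  "Z M \<sigma> \<omega> = complex_of_real (\<Prod>i\<in>fset \<sigma>. increment M i \<omega>)"

subsection \<open>Square integrable functionals\<close>

definition l2_inner :: "'a measure \<Rightarrow> ('a \<Rightarrow> complex) \<Rightarrow> ('a \<Rightarrow> complex) \<Rightarrow> complex" where
  "l2_inner P f g = (LINT \<omega>|P. cnj (f \<omega>) * g \<omega>)"

definition l2_norm :: "'a measure \<Rightarrow> ('a \<Rightarrow> complex) \<Rightarrow> real" where
  "l2_norm P f = sqrt (LINT \<omega>|P. (cmod (f \<omega>))\<^sup>2)"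

definition L2 :: "'a measure \<Rightarrow> (nat \<Rightarrow> 'a \<Rightarrow> real) \<Rightarrow> ('a \<Rightarrow> complex) set" where
  "L2 P M = {f \<in> borel_measurable (sigma_of P M UNIV). integrable P (\<lambda>\<omega>. (cmod (f \<omega>))\<^sup>2)}"

text \<open>Totality of the system \<open>Z\<close>: its linear span is dense in \<open>L2 P M\<close>.\<close>

definition chaotic_representation :: "'a measure \<Rightarrow> (nat \<Rightarrow> 'a \<Rightarrow> real) \<Rightarrow> bool" where
  "chaotic_representation P M \<longleftrightarrow>
     (\<forall>\<xi>\<in>L2 P M. \<forall>e>0. \<exists>A c. finite A \<and>
        l2_norm P (\<lambda>\<omega>. \<xi> \<omega> - (\<Sum>\<sigma>\<in>A. c \<sigma> * Z M \<sigma> \<omega>)) < e)"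

subsection \<open>Testing and generalized functionals\<close>

definition lam :: "nat fset \<Rightarrow> real" where
  "lam \<sigma> = (\<Prod>k\<in>fset \<sigma>. real (k + 1))"

text \<open>
  \<open>pnorm\<close> is real-valued, hence meaningful only on \<open>S_p\<close>: finiteness of the \<open>p\<close>-norm is
  expressed as summability of its nonnegative series.
\<close>

definition pnorm :: "'a measure \<Rightarrow> (nat \<Rightarrow> 'a \<Rightarrow> real) \<Rightarrow> real \<Rightarrow> ('a \<Rightarrow> complex) \<Rightarrow> real" where
  "pnorm P M p \<xi> = sqrt (\<Sum>\<^sub>\<infinity>\<sigma>. lam \<sigma> powr (2 * p) * (cmod (l2_inner P (Z M \<sigma>) \<xi>))\<^sup>2)"

definition S_p :: "'a measure \<Rightarrow> (nat \<Rightarrow> 'a \<Rightarrow> real) \<Rightarrow> real \<Rightarrow> ('a \<Rightarrow> complex) set" where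
  "S_p P M p = {\<xi> \<in> L2 P M.
     (\<lambda>\<sigma>. lam \<sigma> powr (2 * p) * (cmod (l2_inner P (Z M \<sigma>) \<xi>))\<^sup>2) summable_on UNIV}"

definition testing :: "'a measure \<Rightarrow> (nat \<Rightarrow> 'a \<Rightarrow> real) \<Rightarrow> ('a \<Rightarrow> complex) set" where
  "testing P M = (\<Inter>p::nat. S_p P M (real p))"

definition testing_topology ::
    "'a measure \<Rightarrow> (nat \<Rightarrow> 'a \<Rightarrow> real) \<Rightarrow> ('a \<Rightarrow> complex) topology" where
  "testing_topology P M = topology_generated_by
     {{\<xi> \<in> testing P M. pnorm P M p (\<lambda>\<omega>. \<xi> \<omega> - \<zeta> \<omega>) < r} | p \<zeta> r.
        0 \<le> p \<and> \<zeta> \<in> testing P M \<and> 0 < r}"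

text \<open>
  The dual of \<open>testing P M\<close>. Almost surely equal functions have distance zero in every
  \<open>p\<close>-norm, so continuity forces a functional to agree on them.
\<close>

definition generalized ::
    "'a measure \<Rightarrow> (nat \<Rightarrow> 'a \<Rightarrow> real) \<Rightarrow> (('a \<Rightarrow> complex) \<Rightarrow> complex) set" where
  "generalized P M = {\<Phi>.
     (\<forall>\<xi>\<in>testing P M. \<forall>\<zeta>\<in>testing P M. \<Phi> (\<lambda>\<omega>. \<xi> \<omega> + \<zeta> \<omega>) = \<Phi> \<xi> + \<Phi> \<zeta>) \<and>
     (\<forall>c. \<forall>\<xi>\<in>testing P M. \<Phi> (\<lambda>\<omega>. c * \<xi> \<omega>) = c * \<Phi> \<xi>) \<and>
     continuous_map (testing_topology P M) euclidean \<Phi>}"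

definition fock_transform ::
    "(nat \<Rightarrow> 'a \<Rightarrow> real) \<Rightarrow> (('a \<Rightarrow> complex) \<Rightarrow> complex) \<Rightarrow> nat fset \<Rightarrow> complex" where
  "fock_transform M \<Phi> \<sigma> = \<Phi> (Z M \<sigma>)"

definition Phi :: "'a measure \<Rightarrow> ('a \<Rightarrow> complex) \<Rightarrow> ('a \<Rightarrow> complex) \<Rightarrow> complex" where
  "Phi P \<eta> \<xi> = l2_inner P \<eta> \<xi>"

end

theory Submission
  imports Defs
begin

text \<open>
  The Fock transform of \<open>Phi P \<eta>\<close> at \<open>\<sigma>\<close> is the conjugate of the Fourier coefficient
  \<open>\<langle>Z\<^sub>\<sigma>, \<eta>\<rangle>\<close>, so the theorem says that the testing functionals are exactly those with rapidly
  decreasing coefficients.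

  That a testing functional has such coefficients holds because each term of the convergent series
  of its \<open>p\<close>-norm is at most the whole series (\<open>fock_transform_decay\<close>).

  For the other direction the decisive fact is that \<open>\<lambda>\<^sub>\<sigma>\<^sup>-\<^sup>2\<close> is summable over all finite sets
  (\<open>summable_lam\<close>): finite partial sums are dominated by the expansion of
  \<open>\<Prod>\<^sub>k (1 + (k + 1)\<^sup>-\<^sup>2)\<close>. Hence a rapidly decreasing \<open>F\<close> is absolutely summable, and with it
  \<open>\<Sum> cnj (F \<sigma>) Z\<^sub>\<sigma>\<close> converges absolutely almost surely; the Cauchy-Schwarz inequality for the weights
  \<open>|F \<sigma>|\<close> shows that the sum is square integrable (\<open>exists_L2_with_coefficients\<close>). Its
  coefficients are found by integrating term by term. Decay of every order then makes all its \<open>p\<close>-norms finite.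

  Two facts about \<open>Z\<close> are behind this. Orthonormality (\<open>prod_increment_orthonormal\<close>) comes from
  conditioning on the past of the largest index that occurs: given that past, the increment has mean
  \<open>0\<close> and second moment \<open>1\<close>. Totality, by the best approximation property of Fourier sums, yields
  the inequality \<open>\<parallel>f\<parallel>\<^sup>2 \<le> \<Sum> |\<langle>Z\<^sub>\<sigma>, f\<rangle>|\<^sup>2\<close> (\<open>l2_norm_le_coefficients\<close>). It gives uniqueness, and also
  the continuity of \<open>Phi P \<eta>\<close>, since it says that the \<open>L\<^sup>2\<close>-norm is at most the \<open>0\<close>-norm.
\<close>

section \<open>Square integrable complex functions\<close>

definition square_integrable :: "'a measure \<Rightarrow> ('a \<Rightarrow> complex) \<Rightarrow> bool" where
  "square_integrable P f \<longleftrightarrow> f \<in> borel_measurable P \<and> integrable P (\<lambda>\<omega>. (cmod (f \<omega>))\<^sup>2)"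

lemma square_integrable_measurable:
  "square_integrable P f \<Longrightarrow> f \<in> borel_measurable P"
  by (simp add: square_integrable_def)

text \<open>
  The inner product is a Bochner integral, which is \<open>0\<close> on functions that are not integrable; its
  algebraic laws depend on this lemma.
\<close>

lemma integrable_cnj_mult:
  assumes f: "square_integrable P f" and g: "square_integrable P g"
  shows "integrable P (\<lambda>\<omega>. cnj (f \<omega>) * g \<omega>)"
proof (rule Bochner_Integration.integrable_bound)
  show "integrable P (\<lambda>\<omega>. (cmod (f \<omega>))\<^sup>2 + (cmod (g \<omega>))\<^sup>2)"
    using f g by (simp add: square_integrable_def)
  have [measurable]: "f \<in> borel_measurable P" "g \<in> borel_measurable P"
    using f g by (auto simp: square_integrable_def)
  have [measurable]: "(\<lambda>\<omega>. cnj (f \<omega>)) \<in> borel_measurable P"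
    by (rule borel_measurable_continuous_on[where f = cnj, OF continuous_on_cnj[OF continuous_on_id]])
       simp
  show "(\<lambda>\<omega>. cnj (f \<omega>) * g \<omega>) \<in> borel_measurable P"
    by measurable
  show "AE \<omega> in P. norm (cnj (f \<omega>) * g \<omega>) \<le> norm ((cmod (f \<omega>))\<^sup>2 + (cmod (g \<omega>))\<^sup>2)"
  proof (rule AE_I2)
    fix \<omega>
    have "2 * (cmod (f \<omega>) * cmod (g \<omega>)) \<le> (cmod (f \<omega>))\<^sup>2 + (cmod (g \<omega>))\<^sup>2"
      using sum_squares_bound[of "cmod (f \<omega>)" "cmod (g \<omega>)"] by simp
    moreover have "0 \<le> cmod (f \<omega>) * cmod (g \<omega>)"
      by simp
    ultimately have "cmod (f \<omega>) * cmod (g \<omega>) \<le> (cmod (f \<omega>))\<^sup>2 + (cmod (g \<omega>))\<^sup>2"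
      by linarith
    then show "norm (cnj (f \<omega>) * g \<omega>) \<le> norm ((cmod (f \<omega>))\<^sup>2 + (cmod (g \<omega>))\<^sup>2)"
      by (simp add: norm_mult)
  qed
qed

lemma square_integrable_add:
  assumes f: "square_integrable P f" and g: "square_integrable P g"
  shows "square_integrable P (\<lambda>\<omega>. f \<omega> + g \<omega>)"
  unfolding square_integrable_def
proof
  have [measurable]: "f \<in> borel_measurable P" "g \<in> borel_measurable P"
    using f g by (auto simp: square_integrable_def)
  show "(\<lambda>\<omega>. f \<omega> + g \<omega>) \<in> borel_measurable P"
    by measurable
  show "integrable P (\<lambda>\<omega>. (cmod (f \<omega> + g \<omega>))\<^sup>2)"
  proof (rule Bochner_Integration.integrable_bound)
    show "integrable P (\<lambda>\<omega>. 2 * (cmod (f \<omega>))\<^sup>2 + 2 * (cmod (g \<omega>))\<^sup>2)"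
      using f g by (simp add: square_integrable_def)
    show "(\<lambda>\<omega>. (cmod (f \<omega> + g \<omega>))\<^sup>2) \<in> borel_measurable P"
      by measurable
    show "AE \<omega> in P. norm ((cmod (f \<omega> + g \<omega>))\<^sup>2) \<le> norm (2 * (cmod (f \<omega>))\<^sup>2 + 2 * (cmod (g \<omega>))\<^sup>2)"
    proof (rule AE_I2)
      fix \<omega>
      have "(cmod (f \<omega> + g \<omega>))\<^sup>2 \<le> (cmod (f \<omega>) + cmod (g \<omega>))\<^sup>2"
        by (intro power_mono norm_triangle_ineq) simp
      also have "\<dots> \<le> 2 * (cmod (f \<omega>))\<^sup>2 + 2 * (cmod (g \<omega>))\<^sup>2"
        using sum_squares_bound[of "cmod (f \<omega>)" "cmod (g \<omega>)"]
        by (simp add: power2_sum)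
      finally show "norm ((cmod (f \<omega> + g \<omega>))\<^sup>2) \<le> norm (2 * (cmod (f \<omega>))\<^sup>2 + 2 * (cmod (g \<omega>))\<^sup>2)"
        by simp
    qed
  qed
qed

lemma square_integrable_cmult:
  "square_integrable P f \<Longrightarrow> square_integrable P (\<lambda>\<omega>. c * f \<omega>)"
  unfolding square_integrable_def by (auto simp: norm_mult power_mult_distrib)

lemma square_integrable_diff:
  "square_integrable P f \<Longrightarrow> square_integrable P g \<Longrightarrow> square_integrable P (\<lambda>\<omega>. f \<omega> - g \<omega>)"
  using square_integrable_add[of P f "\<lambda>\<omega>. - 1 * g \<omega>"] square_integrable_cmult[of P g "- 1"]
  by simp

lemma square_integrable_sum:
  assumes "\<And>\<sigma>. \<sigma> \<in> A \<Longrightarrow> square_integrable P (f \<sigma>)"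
  shows "square_integrable P (\<lambda>\<omega>. \<Sum>\<sigma>\<in>A. f \<sigma> \<omega>)"
  using assms
  by (induction A rule: infinite_finite_induct)
     (auto intro!: square_integrable_add simp: square_integrable_def[of P "\<lambda>\<omega>. 0"])

lemma l2_inner_add_right:
  "square_integrable P f \<Longrightarrow> square_integrable P g \<Longrightarrow> square_integrable P h \<Longrightarrow>
    l2_inner P f (\<lambda>\<omega>. g \<omega> + h \<omega>) = l2_inner P f g + l2_inner P f h"
  by (simp add: l2_inner_def distrib_left integrable_cnj_mult)

lemma l2_inner_diff_right:
  "square_integrable P f \<Longrightarrow> square_integrable P g \<Longrightarrow> square_integrable P h \<Longrightarrow>
    l2_inner P f (\<lambda>\<omega>. g \<omega> - h \<omega>) = l2_inner P f g - l2_inner P f h"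
  by (simp add: l2_inner_def right_diff_distrib integrable_cnj_mult)

lemma l2_inner_cmult_right: "l2_inner P f (\<lambda>\<omega>. c * g \<omega>) = c * l2_inner P f g"
proof -
  have "l2_inner P f (\<lambda>\<omega>. c * g \<omega>) = (LINT \<omega>|P. c * (cnj (f \<omega>) * g \<omega>))"
    by (simp add: l2_inner_def mult.left_commute)
  then show ?thesis
    by (simp add: l2_inner_def)
qed

lemma l2_inner_commute: "l2_inner P g f = cnj (l2_inner P f g)"
proof -
  have "cnj (l2_inner P f g) = (LINT \<omega>|P. cnj (cnj (f \<omega>) * g \<omega>))"
    unfolding l2_inner_def by (rule Bochner_Integration.integral_cnj[symmetric])
  then show ?thesis
    by (simp add: l2_inner_def mult.commute)
qed

lemma l2_inner_sum_right:
  assumes "square_integrable P f" "\<And>\<sigma>. \<sigma> \<in> A \<Longrightarrow> square_integrable P (g \<sigma>)"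
  shows "l2_inner P f (\<lambda>\<omega>. \<Sum>\<sigma>\<in>A. c \<sigma> * g \<sigma> \<omega>) = (\<Sum>\<sigma>\<in>A. c \<sigma> * l2_inner P f (g \<sigma>))"
proof -
  have "l2_inner P f (\<lambda>\<omega>. \<Sum>\<sigma>\<in>A. c \<sigma> * g \<sigma> \<omega>) = (LINT \<omega>|P. (\<Sum>\<sigma>\<in>A. cnj (f \<omega>) * (c \<sigma> * g \<sigma> \<omega>)))"
    by (simp add: l2_inner_def sum_distrib_left)
  also have "\<dots> = (\<Sum>\<sigma>\<in>A. l2_inner P f (\<lambda>\<omega>. c \<sigma> * g \<sigma> \<omega>))"
    unfolding l2_inner_def
    by (rule Bochner_Integration.integral_sum)
       (intro integrable_cnj_mult square_integrable_cmult assms)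
  finally show ?thesis
    by (simp add: l2_inner_cmult_right)
qed

lemma l2_norm_square: "(l2_norm P f)\<^sup>2 = (LINT \<omega>|P. (cmod (f \<omega>))\<^sup>2)"
  by (simp add: l2_norm_def)

lemma l2_inner_self: "l2_inner P f f = of_real ((l2_norm P f)\<^sup>2)"
proof -
  have "cnj (f \<omega>) * f \<omega> = of_real ((cmod (f \<omega>))\<^sup>2)" for \<omega>
    by (metis complex_norm_square mult.commute)
  then show ?thesis
    by (simp add: l2_inner_def l2_norm_square del: of_real_power)
qed

lemma l2_norm_nonneg [simp]: "0 \<le> l2_norm P f"
  by (simp add: l2_norm_def)

text \<open>
  The inequality for nonnegative extended integrals, applied to the absolute values.
\<close>

lemma l2_Cauchy_Schwarz:
  assumes f: "square_integrable P f" and g: "square_integrable P g"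
  shows "cmod (l2_inner P f g) \<le> l2_norm P f * l2_norm P g"
proof -
  have [measurable]: "f \<in> borel_measurable P" "g \<in> borel_measurable P"
    using f g by (auto simp: square_integrable_def)
  let ?I = "LINT \<omega>|P. cmod (f \<omega>) * cmod (g \<omega>)"
  have int: "integrable P (\<lambda>\<omega>. cmod (f \<omega>) * cmod (g \<omega>))"
    using integrable_norm[OF integrable_cnj_mult[OF f g]] by (simp add: norm_mult)
  have nn: "(\<integral>\<^sup>+ \<omega>. ennreal (cmod (f \<omega>)) * ennreal (cmod (g \<omega>)) \<partial>P) = ennreal ?I"
    using nn_integral_eq_integral[OF int] by (simp add: ennreal_mult)
  have sq: "(\<integral>\<^sup>+ \<omega>. (ennreal (cmod (h \<omega>)))\<^sup>2 \<partial>P) = ennreal ((l2_norm P h)\<^sup>2)"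
    if "square_integrable P h" for h
    using that unfolding l2_norm_square square_integrable_def
    by (simp add: ennreal_power nn_integral_eq_integral)
  have "(ennreal ?I)\<^sup>2 \<le> ennreal ((l2_norm P f)\<^sup>2) * ennreal ((l2_norm P g)\<^sup>2)"
    unfolding nn[symmetric] sq[OF f, symmetric] sq[OF g, symmetric]
    by (rule Cauchy_Schwarz_nn_integral) auto
  then have "ennreal (?I\<^sup>2) \<le> ennreal ((l2_norm P f * l2_norm P g)\<^sup>2)"
    by (simp add: ennreal_power ennreal_mult power_mult_distrib)
  then have "?I\<^sup>2 \<le> (l2_norm P f * l2_norm P g)\<^sup>2"
    by simp
  then have "?I \<le> l2_norm P f * l2_norm P g"
    by (rule power2_le_imp_le) simp
  moreover have "cmod (l2_inner P f g) \<le> ?I"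
    unfolding l2_inner_def using integral_norm_bound[of P "\<lambda>\<omega>. cnj (f \<omega>) * g \<omega>"]
    by (simp add: norm_mult)
  ultimately show ?thesis
    by simp
qed

section \<open>Summability of the weights\<close>

lemma lam_pos: "0 < lam \<sigma>" and lam_ge_1: "1 \<le> lam \<sigma>"
  unfolding lam_def by (auto intro!: prod_pos prod_ge_1)

text \<open>
  For \<open>n > 0\<close> the sharper bound \<open>4 * n / (n + 1)\<close> survives the induction, because
  with \<open>x = n + 1\<close> its next value is larger by the factor \<open>x\<^sup>2 / (x\<^sup>2 - 1)\<close>, which exceeds the new
  factor \<open>1 + 1 / x\<^sup>2\<close> of the product.
\<close>

lemma prod_one_plus_inverse_square_le:
  "(\<Prod>k<n. 1 + 1 / (real (k + 1))\<^sup>2) \<le> 4"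
proof (cases n)
  case (Suc m)
  have step: "4 * (x - 1) / x * (1 + 1 / x\<^sup>2) \<le> 4 * x / (x + 1)" if "1 < x" for x :: real
  proof -
    have "4 * (x - 1) / x * (1 + 1 / x\<^sup>2) = 4 * ((x - 1) * (x\<^sup>2 + 1)) / x ^ 3"
      using that by (simp add: field_simps power2_eq_square power3_eq_cube)
    also have "\<dots> = 4 * ((x - 1) * (x + 1) * (x\<^sup>2 + 1)) / (x ^ 3 * (x + 1))"
      using that by simp
    also have "(x - 1) * (x + 1) * (x\<^sup>2 + 1) = x ^ 4 - 1"
      by (simp add: algebra_simps power2_eq_square power4_eq_xxxx)
    also have "4 * (x ^ 4 - 1) / (x ^ 3 * (x + 1)) \<le> 4 * x ^ 4 / (x ^ 3 * (x + 1))"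
      using that by (intro divide_right_mono) auto
    also have "\<dots> = 4 * x / (x + 1)"
      using that by (simp add: power3_eq_cube power4_eq_xxxx)
    finally show ?thesis .
  qed
  have "(\<Prod>k<Suc m. 1 + 1 / (real (k + 1))\<^sup>2) \<le> 4 * (real m + 1) / (real m + 2)" for m
  proof (induction m)
    case (Suc m)
    let ?x = "real m + 2"
    have "(\<Prod>k<Suc (Suc m). 1 + 1 / (real (k + 1))\<^sup>2)
        \<le> 4 * (?x - 1) / ?x * (1 + 1 / ?x\<^sup>2)"
      using mult_right_mono[OF Suc.IH, of "1 + 1 / ?x\<^sup>2"]
      by (simp add: add.commute)
    also have "\<dots> \<le> 4 * ?x / (?x + 1)"
      by (rule step) simp
    finally show ?case
      by (simp add: add.commute)
  qed simp
  also have "4 * (real m + 1) / (real m + 2) \<le> 4"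
    by (simp add: field_simps)
  finally show ?thesis
    using Suc by simp
qed simp

text \<open>
  A finite family of finite sets lies in the power set of some \<open>{..<n}\<close>, and the sum of the weights
  over that power set is the expanded product \<open>\<Prod>k<n. 1 + 1 / (k + 1)\<^sup>2\<close>.
\<close>

lemma summable_lam: "(\<lambda>\<sigma>. lam \<sigma> powr (- 2)) summable_on UNIV"
proof (rule nonneg_bounded_partial_sums_imp_summable_on)
  show "\<forall>\<^sub>F A in finite_subsets_at_top UNIV. (\<Sum>\<sigma>\<in>A. lam \<sigma> powr (- 2)) \<le> 4"
  proof (rule eventually_finite_subsets_at_top_weakI)
    fix A :: "nat fset set"
    assume A: "finite A"
    obtain n where n: "(\<Union>\<sigma>\<in>A. fset \<sigma>) \<subseteq> {..<n}"
      using finite_nat_bounded[of "\<Union>\<sigma>\<in>A. fset \<sigma>"] A by auto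
    let ?w = "\<lambda>X. \<Prod>k\<in>X. 1 / (real (k + 1))\<^sup>2"
    have "lam \<sigma> powr (- 2) = ?w (fset \<sigma>)" for \<sigma>
      using lam_pos[of \<sigma>]
      by (simp add: powr_minus lam_def prod_inversef inverse_eq_divide prod_dividef
            flip: prod_power_distrib)
    then have "(\<Sum>\<sigma>\<in>A. lam \<sigma> powr (- 2)) = (\<Sum>X\<in>fset ` A. ?w X)"
      by (subst sum.reindex) (auto simp: inj_on_def fset_inject)
    also have "\<dots> \<le> (\<Sum>X\<in>Pow {..<n}. ?w X)"
      using n by (intro sum_mono2) (auto intro!: prod_nonneg)
    also have "\<dots> = (\<Prod>k<n. 1 / (real (k + 1))\<^sup>2 + 1)"
      by (subst prod_add) simp_all
    also have "\<dots> \<le> 4"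
      using prod_one_plus_inverse_square_le[of n] by (simp add: add.commute)
    finally show "(\<Sum>\<sigma>\<in>A. lam \<sigma> powr (- 2)) \<le> 4" .
  qed
qed simp

section \<open>Orthonormality of the chaos system\<close>

text \<open>
  The real conditional expectation determines the extended nonnegative one through the integrals
  over sets of \<open>G\<close>. Stating the result for extended nonnegative \<open>f\<close> is what later yields
  integrability of \<open>f * g\<close> rather than presupposing it.
\<close>

lemma nn_integral_mult_cond_exp_one:
  assumes "finite_measure_subalgebra P G"
    and g: "integrable P g" "\<And>\<omega>. 0 \<le> g \<omega>"
    and one: "AE \<omega> in P. real_cond_exp P G g \<omega> = 1"
    and f: "f \<in> borel_measurable G"
  shows "(\<integral>\<^sup>+\<omega>. f \<omega> * ennreal (g \<omega>) \<partial>P) = (\<integral>\<^sup>+\<omega>. f \<omega> \<partial>P)"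
proof -
  interpret finite_measure_subalgebra P G by fact
  have [measurable]: "g \<in> borel_measurable P"
    using g by auto
  have "AE \<omega> in P. (1::ennreal) = nn_cond_exp P G (\<lambda>\<omega>. ennreal (g \<omega>)) \<omega>"
  proof (rule nn_cond_exp_charact)
    fix A assume A: "A \<in> sets G"
    then have AP [measurable]: "A \<in> sets P"
      using subalg by (auto simp: subalgebra_def)
    have int: "integrable P (\<lambda>\<omega>. indicator A \<omega> * g \<omega>)"
      using integrable_mult_indicator[OF AP g(1)] by simp
    have "(\<integral>\<^sup>+\<omega>\<in>A. ennreal (g \<omega>) \<partial>P) = (\<integral>\<^sup>+\<omega>. ennreal (indicator A \<omega> * g \<omega>) \<partial>P)"
      by (intro nn_integral_cong) (auto simp: indicator_def)
    also have "\<dots> = ennreal (\<integral>\<omega>. indicator A \<omega> * g \<omega> \<partial>P)"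
      using g by (intro nn_integral_eq_integral int) auto
    also have "(\<integral>\<omega>. indicator A \<omega> * g \<omega> \<partial>P) = (\<integral>\<omega>. indicator A \<omega> * real_cond_exp P G g \<omega> \<partial>P)"
      using real_cond_exp_intA[OF g(1) A] by (simp add: set_lebesgue_integral_def)
    also have "\<dots> = (\<integral>\<omega>. indicator A \<omega> \<partial>P)"
      using one by (intro integral_cong_AE) auto
    also have "ennreal \<dots> = (\<integral>\<^sup>+\<omega>\<in>A. 1 \<partial>P)"
      by (simp add: emeasure_eq_measure)
    finally show "(\<integral>\<^sup>+\<omega>\<in>A. ennreal (g \<omega>) \<partial>P) = (\<integral>\<^sup>+\<omega>\<in>A. 1 \<partial>P)" .
  qed auto
  then have "(\<integral>\<^sup>+\<omega>. f \<omega> \<partial>P) = (\<integral>\<^sup>+\<omega>. f \<omega> * nn_cond_exp P G (\<lambda>\<omega>. ennreal (g \<omega>)) \<omega> \<partial>P)"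
    by (intro nn_integral_cong_AE) auto
  also have "\<dots> = (\<integral>\<^sup>+\<omega>. f \<omega> * ennreal (g \<omega>) \<partial>P)"
    using f by (intro nn_cond_exp_intg) auto
  finally show ?thesis by simp
qed

lemma integral_mult_cond_exp_one:
  fixes f g :: "'a \<Rightarrow> real"
  assumes "finite_measure_subalgebra P G"
    and g: "integrable P g" "\<And>\<omega>. 0 \<le> g \<omega>"
    and one: "AE \<omega> in P. real_cond_exp P G g \<omega> = 1"
    and f: "f \<in> borel_measurable G" "integrable P f"
  shows "integrable P (\<lambda>\<omega>. f \<omega> * g \<omega>)" and "(\<integral>\<omega>. f \<omega> * g \<omega> \<partial>P) = (\<integral>\<omega>. f \<omega> \<partial>P)"
proof -
  interpret finite_measure_subalgebra P G by fact
  have [measurable]: "g \<in> borel_measurable P" "f \<in> borel_measurable P" "f \<in> borel_measurable G"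
    using g f by auto
  have "(\<integral>\<^sup>+\<omega>. ennreal (norm (f \<omega> * g \<omega>)) \<partial>P) = (\<integral>\<^sup>+\<omega>. ennreal (norm (f \<omega>)) * ennreal (g \<omega>) \<partial>P)"
    using g(2) by (simp add: abs_mult ennreal_mult)
  also have "\<dots> = (\<integral>\<^sup>+\<omega>. ennreal (norm (f \<omega>)) \<partial>P)"
    by (rule nn_integral_mult_cond_exp_one[OF assms(1) g one]) measurable
  also have "\<dots> < \<infinity>"
    using f(2) by (simp add: integrable_iff_bounded)
  finally show int: "integrable P (\<lambda>\<omega>. f \<omega> * g \<omega>)"
    by (intro integrableI_bounded) auto
  have "(\<integral>\<omega>. f \<omega> * g \<omega> \<partial>P) = (\<integral>\<omega>. f \<omega> * real_cond_exp P G g \<omega> \<partial>P)"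
    by (intro real_cond_exp_intg(2)[symmetric] int f) auto
  also have "\<dots> = (\<integral>\<omega>. f \<omega> \<partial>P)"
    using one by (intro integral_cong_AE) auto
  finally show "(\<integral>\<omega>. f \<omega> * g \<omega> \<partial>P) = (\<integral>\<omega>. f \<omega> \<partial>P)" .
qed

locale normal_martingale_space = prob_space P for P :: "'a measure" +
  fixes M :: "nat \<Rightarrow> 'a \<Rightarrow> real"
  assumes normal: "normal_martingale P M"
begin

lemma measurable_M [measurable]: "M n \<in> borel_measurable P"
  and integrable_M_square: "integrable P (\<lambda>\<omega>. (M n \<omega>)\<^sup>2)"
  using normal by (auto simp: normal_martingale_def)

lemma integrable_M: "integrable P (M n)"
  by (rule square_integrable_imp_integrable[OF measurable_M integrable_M_square])

lemma space_sigma_of: "space (sigma_of P M K) = space P"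
  by (auto simp: sigma_of_def intro!: space_measure_of_conv)

lemma sets_sigma_of:
  "sets (sigma_of P M K) =
    sigma_sets (space P) (\<Union>k\<in>K. {M k -` B \<inter> space P | B. B \<in> sets borel})"
  unfolding sigma_of_def by (rule sets_measure_of) auto

lemma subalgebra_sigma_of: "subalgebra P (sigma_of P M K)"
  unfolding subalgebra_def space_sigma_of sets_sigma_of
  by (auto intro!: sets.sigma_sets_subset elim!: measurable_sets[OF measurable_M])

lemma finite_subalgebra_sigma_of: "finite_measure_subalgebra P (sigma_of P M K)"
  by unfold_locales (rule subalgebra_sigma_of)

lemma measurable_sigma_of_M: "k \<in> K \<Longrightarrow> M k \<in> borel_measurable (sigma_of P M K)"
  by (rule measurableI) (auto simp: space_sigma_of sets_sigma_of)

lemma measurable_sigma_of_imp: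
  "f \<in> borel_measurable (sigma_of P M K) \<Longrightarrow> f \<in> borel_measurable P"
  by (rule measurable_from_subalg[OF subalgebra_sigma_of])

lemma measurable_sigma_of_increment:
  assumes "n \<in> K" "n \<noteq> 0 \<Longrightarrow> n - 1 \<in> K"
  shows "increment M n \<in> borel_measurable (sigma_of P M K)"
proof (cases "n = 0")
  case True
  then show ?thesis
    using measurable_sigma_of_M[OF assms(1)] by (simp add: increment_def[abs_def])
next
  case False
  then show ?thesis
    using measurable_sigma_of_M[OF assms(1)] measurable_sigma_of_M[OF assms(2)[OF False]]
    by (simp add: increment_def[abs_def])
qed

lemma measurable_increment [measurable]: "increment M n \<in> borel_measurable P"
  by (rule measurable_sigma_of_imp[where K = UNIV]) (auto intro: measurable_sigma_of_increment)

lemma integrable_increment_square: "integrable P (\<lambda>\<omega>. (increment M n \<omega>)\<^sup>2)"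
proof (cases "n = 0")
  case True
  then show ?thesis
    using integrable_M_square[of 0] by (simp add: increment_def)
next
  case False
  have bound: "(a - b)\<^sup>2 \<le> 2 * a\<^sup>2 + 2 * b\<^sup>2" for a b :: real
    using sum_squares_bound[of a "- b"] by (simp add: power2_diff)
  show ?thesis
  proof (rule Bochner_Integration.integrable_bound)
    show "integrable P (\<lambda>\<omega>. 2 * (M n \<omega>)\<^sup>2 + 2 * (M (n - 1) \<omega>)\<^sup>2)"
      using integrable_M_square by auto
    show "AE \<omega> in P. norm ((increment M n \<omega>)\<^sup>2) \<le> norm (2 * (M n \<omega>)\<^sup>2 + 2 * (M (n - 1) \<omega>)\<^sup>2)"
    proof (rule AE_I2)
      fix \<omega>
      show "norm ((increment M n \<omega>)\<^sup>2) \<le> norm (2 * (M n \<omega>)\<^sup>2 + 2 * (M (n - 1) \<omega>)\<^sup>2)"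
        using False bound[of "M n \<omega>" "M (n - 1) \<omega>"] by (simp add: increment_def)
    qed
  qed measurable
qed

lemma cond_exp_increment:
  "AE \<omega> in P. real_cond_exp P (sigma_of P M {..<n}) (increment M n) \<omega> = 0"
proof (cases n)
  case 0
  then show ?thesis
    using normal by (simp add: normal_martingale_def increment_def[abs_def])
next
  case (Suc m)
  interpret finite_measure_subalgebra P "sigma_of P M {..m}"
    by (rule finite_subalgebra_sigma_of)
  have "AE \<omega> in P. real_cond_exp P (sigma_of P M {..m}) (M (Suc m)) \<omega> = M m \<omega>"
    using normal by (simp add: normal_martingale_def)
  moreover have "AE \<omega> in P. real_cond_exp P (sigma_of P M {..m}) (M m) \<omega> = M m \<omega>"
    by (intro real_cond_exp_F_meas integrable_M measurable_sigma_of_M) simp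
  moreover have "AE \<omega> in P. real_cond_exp P (sigma_of P M {..m}) (\<lambda>\<omega>. M (Suc m) \<omega> - M m \<omega>) \<omega>
      = real_cond_exp P (sigma_of P M {..m}) (M (Suc m)) \<omega>
        - real_cond_exp P (sigma_of P M {..m}) (M m) \<omega>"
    by (intro real_cond_exp_diff integrable_M)
  ultimately have "AE \<omega> in P. real_cond_exp P (sigma_of P M {..m}) (\<lambda>\<omega>. M (Suc m) \<omega> - M m \<omega>) \<omega> = 0"
    by eventually_elim simp
  then show ?thesis
    by (simp add: Suc increment_def[abs_def] lessThan_Suc_atMost)
qed

text \<open>
  With \<open>N\<close> the increment at time \<open>m + 1\<close>, \<open>N\<^sup>2 = M\<^sub>m\<^sub>+\<^sub>1\<^sup>2 - M\<^sub>m\<^sup>2 - 2 * M\<^sub>m * N\<close>. Conditionally on the past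
  the first difference has mean \<open>1\<close>, and the cross term vanishes because \<open>M\<^sub>m\<close> is known and \<open>N\<close> is
  centred.
\<close>

lemma cond_exp_increment_square:
  "AE \<omega> in P. real_cond_exp P (sigma_of P M {..<n}) (\<lambda>\<omega>. (increment M n \<omega>)\<^sup>2) \<omega> = 1"
proof (cases n)
  case 0
  then show ?thesis
    using normal by (simp add: normal_martingale_def increment_def[abs_def])
next
  case (Suc m)
  let ?G = "sigma_of P M {..m}"
  interpret finite_measure_subalgebra P ?G
    by (rule finite_subalgebra_sigma_of)
  have [measurable]: "M m \<in> borel_measurable ?G"
    by (intro measurable_sigma_of_M) simp
  have sq: "(increment M n \<omega>)\<^sup>2 = (M (Suc m) \<omega>)\<^sup>2 - (M m \<omega>)\<^sup>2 - 2 * M m \<omega> * increment M n \<omega>" for \<omega>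
    by (simp add: Suc increment_def power2_eq_square algebra_simps)
  \<comment> \<open>All the other terms of the identity are integrable, hence so is the product.\<close>
  have cross: "integrable P (\<lambda>\<omega>. 2 * M m \<omega> * increment M n \<omega>)"
  proof -
    have "(\<lambda>\<omega>. 2 * M m \<omega> * increment M n \<omega>)
        = (\<lambda>\<omega>. (M (Suc m) \<omega>)\<^sup>2 - (M m \<omega>)\<^sup>2 - (increment M n \<omega>)\<^sup>2)"
      by (simp add: sq)
    then show ?thesis
      by (simp add: integrable_M_square integrable_increment_square)
  qed
  have "AE \<omega> in P. real_cond_exp P ?G (\<lambda>\<omega>. (M (Suc m) \<omega>)\<^sup>2) \<omega> = (M m \<omega>)\<^sup>2 + 1"
    using normal by (simp add: normal_martingale_def)
  moreover have "AE \<omega> in P. real_cond_exp P ?G (\<lambda>\<omega>. (M m \<omega>)\<^sup>2) \<omega> = (M m \<omega>)\<^sup>2"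
    by (intro real_cond_exp_F_meas integrable_M_square) measurable
  moreover have "AE \<omega> in P. real_cond_exp P ?G (\<lambda>\<omega>. 2 * M m \<omega> * increment M n \<omega>) \<omega>
      = 2 * M m \<omega> * real_cond_exp P ?G (increment M n) \<omega>"
    by (intro real_cond_exp_mult cross) measurable
  moreover have "AE \<omega> in P. real_cond_exp P ?G (increment M n) \<omega> = 0"
    using cond_exp_increment[of n] by (simp add: Suc lessThan_Suc_atMost)
  moreover have "AE \<omega> in P. real_cond_exp P ?G (\<lambda>\<omega>. (M (Suc m) \<omega>)\<^sup>2 - (M m \<omega>)\<^sup>2) \<omega>
      = real_cond_exp P ?G (\<lambda>\<omega>. (M (Suc m) \<omega>)\<^sup>2) \<omega> - real_cond_exp P ?G (\<lambda>\<omega>. (M m \<omega>)\<^sup>2) \<omega>"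
    by (intro real_cond_exp_diff integrable_M_square)
  moreover have "AE \<omega> in P. real_cond_exp P ?G
      (\<lambda>\<omega>. ((M (Suc m) \<omega>)\<^sup>2 - (M m \<omega>)\<^sup>2) - 2 * M m \<omega> * increment M n \<omega>) \<omega>
      = real_cond_exp P ?G (\<lambda>\<omega>. (M (Suc m) \<omega>)\<^sup>2 - (M m \<omega>)\<^sup>2) \<omega>
        - real_cond_exp P ?G (\<lambda>\<omega>. 2 * M m \<omega> * increment M n \<omega>) \<omega>"
    by (intro real_cond_exp_diff integrable_M_square cross Bochner_Integration.integrable_diff)
  ultimately have "AE \<omega> in P. real_cond_exp P ?G
      (\<lambda>\<omega>. ((M (Suc m) \<omega>)\<^sup>2 - (M m \<omega>)\<^sup>2) - 2 * M m \<omega> * increment M n \<omega>) \<omega> = 1"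
    by eventually_elim simp
  then show ?thesis
    unfolding sq by (simp add: Suc lessThan_Suc_atMost)
qed

lemma measurable_sigma_of_prod:
  assumes "A \<subseteq> {..<n}"
  shows "(\<lambda>\<omega>. \<Prod>i\<in>A. increment M i \<omega>) \<in> borel_measurable (sigma_of P M {..<n})"
  using assms by (intro borel_measurable_prod measurable_sigma_of_increment) auto

text \<open>
  Condition on the past of the largest index \<open>n\<close>. If \<open>n\<close> lies in both sets, its squared increment
  integrates out to \<open>1\<close> and the claim descends to the smaller index; if it lies in exactly one, the
  centred increment makes the integral vanish. Integrability is part of the induction since products
  of square integrable functions need not be square integrable: it is the conditional second moment
  that keeps \<open>Z\<close> in \<open>L\<^sup>2\<close>.
\<close>

lemma prod_increment_orthonormal:
  assumes "A \<subseteq> {..<n}" "B \<subseteq> {..<n}"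
  shows "integrable P (\<lambda>\<omega>. (\<Prod>i\<in>A. increment M i \<omega>) * (\<Prod>i\<in>B. increment M i \<omega>)) \<and>
    (\<integral>\<omega>. (\<Prod>i\<in>A. increment M i \<omega>) * (\<Prod>i\<in>B. increment M i \<omega>) \<partial>P) = (if A = B then 1 else 0)"
  using assms
proof (induction n arbitrary: A B)
  case 0
  then show ?case
    by (simp add: prob_space)
next
  case (Suc n)
  let ?z = "\<lambda>A \<omega>. \<Prod>i\<in>A. increment M i \<omega>"
  let ?G = "sigma_of P M {..<n}"
  have fin: "finite A" if "A \<subseteq> {..<m}" for A and m :: nat
    using that finite_subset by blast
  have split: "?z A \<omega> = ?z (A - {n}) \<omega> * increment M n \<omega>" if "n \<in> A" "A \<subseteq> {..<Suc n}" for A \<omega>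
    using prod.remove[OF fin[OF that(2)] that(1), of "\<lambda>i. increment M i \<omega>"] by simp
  have sub: "A - {n} \<subseteq> {..<n}" if "A \<subseteq> {..<Suc n}" for A
    using that by (auto simp: less_Suc_eq)
  have square: "integrable P (\<lambda>\<omega>. (?z A \<omega> * increment M n \<omega>)\<^sup>2)" if A: "A \<subseteq> {..<n}" for A
  proof -
    have "integrable P (\<lambda>\<omega>. (?z A \<omega>)\<^sup>2 * (increment M n \<omega>)\<^sup>2)"
    proof (rule integral_mult_cond_exp_one(1)[OF finite_subalgebra_sigma_of
          integrable_increment_square _ cond_exp_increment_square])
      show "(\<lambda>\<omega>. (?z A \<omega>)\<^sup>2) \<in> borel_measurable ?G"
        using measurable_sigma_of_prod[OF A] by simp
      show "integrable P (\<lambda>\<omega>. (?z A \<omega>)\<^sup>2)"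
        using Suc.IH[OF A A] by (simp add: power2_eq_square)
    qed simp
    then show ?thesis
      by (simp add: power_mult_distrib)
  qed
  have one_sided: "integrable P (\<lambda>\<omega>. ?z A \<omega> * ?z B \<omega> * increment M n \<omega>) \<and>
      (\<integral>\<omega>. ?z A \<omega> * ?z B \<omega> * increment M n \<omega> \<partial>P) = 0"
    if A: "A \<subseteq> {..<n}" and B: "B \<subseteq> {..<n}" for A B
  proof -
    interpret finite_measure_subalgebra P ?G
      by (rule finite_subalgebra_sigma_of)
    have [measurable]: "?z A \<in> borel_measurable ?G" "?z B \<in> borel_measurable ?G"
      by (intro measurable_sigma_of_prod A B)+
    have [measurable]: "?z A \<in> borel_measurable P" "?z B \<in> borel_measurable P"
      by measurable
    have int: "integrable P (\<lambda>\<omega>. (?z A \<omega> * ?z B \<omega>) * increment M n \<omega>)"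
    proof (rule Bochner_Integration.integrable_bound)
      show "integrable P (\<lambda>\<omega>. (?z A \<omega> * increment M n \<omega>)\<^sup>2 + (?z B \<omega>)\<^sup>2)"
        using square[OF A] Suc.IH[OF B B] by (simp add: power2_eq_square)
      show "AE \<omega> in P. norm ((?z A \<omega> * ?z B \<omega>) * increment M n \<omega>)
          \<le> norm ((?z A \<omega> * increment M n \<omega>)\<^sup>2 + (?z B \<omega>)\<^sup>2)"
      proof (rule AE_I2)
        fix \<omega>
        have "\<bar>a * b\<bar> \<le> a\<^sup>2 + b\<^sup>2" for a b :: real
        proof -
          have "2 * (\<bar>a\<bar> * \<bar>b\<bar>) \<le> a\<^sup>2 + b\<^sup>2"
            using sum_squares_bound[of "\<bar>a\<bar>" "\<bar>b\<bar>"] by simp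
          moreover have "0 \<le> \<bar>a\<bar> * \<bar>b\<bar>"
            by simp
          ultimately show ?thesis
            unfolding abs_mult by linarith
        qed
        from this[of "?z A \<omega> * increment M n \<omega>" "?z B \<omega>"]
        show "norm ((?z A \<omega> * ?z B \<omega>) * increment M n \<omega>)
            \<le> norm ((?z A \<omega> * increment M n \<omega>)\<^sup>2 + (?z B \<omega>)\<^sup>2)"
          by (simp add: ac_simps)
      qed
    qed measurable
    have "(\<integral>\<omega>. (?z A \<omega> * ?z B \<omega>) * increment M n \<omega> \<partial>P)
        = (\<integral>\<omega>. (?z A \<omega> * ?z B \<omega>) * real_cond_exp P ?G (increment M n) \<omega> \<partial>P)"
      by (intro real_cond_exp_intg(2)[symmetric] int) measurable
    also have "\<dots> = (\<integral>\<omega>. 0 \<partial>P)"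
      using cond_exp_increment[of n] by (intro integral_cong_AE) auto
    finally show ?thesis
      using int by simp
  qed
  consider "n \<notin> A" "n \<notin> B" | "n \<in> A" "n \<notin> B" | "n \<notin> A" "n \<in> B" | "n \<in> A" "n \<in> B"
    by blast
  then show ?case
  proof cases
    case 1
    then show ?thesis
      using Suc.IH[OF sub[OF Suc.prems(1)] sub[OF Suc.prems(2)]] by simp
  next
    case 2
    then have eq: "?z A \<omega> * ?z B \<omega> = ?z (A - {n}) \<omega> * ?z (B - {n}) \<omega> * increment M n \<omega>" for \<omega>
      using split[OF _ Suc.prems(1)] by simp
    have "A \<noteq> B"
      using 2 by blast
    then show ?thesis
      unfolding eq using one_sided[OF sub[OF Suc.prems(1)] sub[OF Suc.prems(2)]] by simp
  next
    case 3
    then have eq: "?z A \<omega> * ?z B \<omega> = ?z (A - {n}) \<omega> * ?z (B - {n}) \<omega> * increment M n \<omega>" for \<omega>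
      using split[OF _ Suc.prems(2)] by simp
    have "A \<noteq> B"
      using 3 by blast
    then show ?thesis
      unfolding eq using one_sided[OF sub[OF Suc.prems(1)] sub[OF Suc.prems(2)]] by simp
  next
    case 4
    then have eq: "?z A \<omega> * ?z B \<omega> = (?z (A - {n}) \<omega> * ?z (B - {n}) \<omega>) * (increment M n \<omega>)\<^sup>2" for \<omega>
      using split[OF _ Suc.prems(1)] split[OF _ Suc.prems(2)] by (simp add: power2_eq_square)
    have meas: "(\<lambda>\<omega>. ?z (A - {n}) \<omega> * ?z (B - {n}) \<omega>) \<in> borel_measurable ?G"
      by (intro borel_measurable_times measurable_sigma_of_prod sub Suc.prems)
    note IH = Suc.IH[OF sub[OF Suc.prems(1)] sub[OF Suc.prems(2)]]
    note red = integral_mult_cond_exp_one[OF finite_subalgebra_sigma_of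
        integrable_increment_square _ cond_exp_increment_square meas conjunct1[OF IH]]
    have "A - {n} = B - {n} \<longleftrightarrow> A = B"
      using 4 by blast
    then show ?thesis
      unfolding eq using red IH by simp
  qed
qed


lemma l2_inner_Z: "l2_inner P (Z M \<sigma>) (Z M \<tau>) = (if \<sigma> = \<tau> then 1 else 0)"
  and square_integrable_Z: "square_integrable P (Z M \<sigma>)"
proof -
  have orth: "integrable P (\<lambda>\<omega>. (\<Prod>i\<in>fset \<sigma>. increment M i \<omega>) * (\<Prod>i\<in>fset \<tau>. increment M i \<omega>)) \<and>
    (\<integral>\<omega>. (\<Prod>i\<in>fset \<sigma>. increment M i \<omega>) * (\<Prod>i\<in>fset \<tau>. increment M i \<omega>) \<partial>P)
      = (if \<sigma> = \<tau> then 1 else 0)" for \<sigma> \<tau>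
  proof -
    obtain n where "fset \<sigma> \<union> fset \<tau> \<subseteq> {..<n}"
      using finite_nat_bounded[of "fset \<sigma> \<union> fset \<tau>"] by auto
    then show ?thesis
      using prod_increment_orthonormal[of "fset \<sigma>" n "fset \<tau>"] by (simp add: fset_inject)
  qed
  have "l2_inner P (Z M \<sigma>) (Z M \<tau>) = (\<integral>\<omega>. complex_of_real
      ((\<Prod>i\<in>fset \<sigma>. increment M i \<omega>) * (\<Prod>i\<in>fset \<tau>. increment M i \<omega>)) \<partial>P)"
    by (simp add: l2_inner_def Z_def)
  also have "\<dots> = (if \<sigma> = \<tau> then 1 else 0)"
    using orth[of \<sigma> \<tau>] by (simp del: of_real_mult of_real_prod)
  finally show "l2_inner P (Z M \<sigma>) (Z M \<tau>) = (if \<sigma> = \<tau> then 1 else 0)" .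
  have "(cmod (Z M \<sigma> \<omega>))\<^sup>2
      = (\<Prod>i\<in>fset \<sigma>. increment M i \<omega>) * (\<Prod>i\<in>fset \<sigma>. increment M i \<omega>)" for \<omega>
    unfolding Z_def norm_of_real by (simp add: power2_eq_square)
  then show "square_integrable P (Z M \<sigma>)"
    using orth[of \<sigma> \<sigma>] by (simp add: square_integrable_def Z_def[abs_def])
qed

lemma Z_in_L2: "Z M \<sigma> \<in> L2 P M"
proof -
  have "(\<lambda>\<omega>. \<Prod>i\<in>fset \<sigma>. increment M i \<omega>) \<in> borel_measurable (sigma_of P M UNIV)"
    by (intro borel_measurable_prod measurable_sigma_of_increment) auto
  then have "Z M \<sigma> \<in> borel_measurable (sigma_of P M UNIV)"
    unfolding Z_def[abs_def] by (rule measurable_compose[OF _ borel_measurable_of_real])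
  then show ?thesis
    using square_integrable_Z[of \<sigma>] by (simp add: L2_def square_integrable_def)
qed

lemma L2_square_integrable: "f \<in> L2 P M \<Longrightarrow> square_integrable P f"
  by (auto simp: L2_def square_integrable_def intro: measurable_sigma_of_imp)

lemma L2_diff: "f \<in> L2 P M \<Longrightarrow> g \<in> L2 P M \<Longrightarrow> (\<lambda>\<omega>. f \<omega> - g \<omega>) \<in> L2 P M"
  using square_integrable_diff[of P f g] L2_square_integrable[of f] L2_square_integrable[of g]
  by (auto simp: L2_def square_integrable_def)

section \<open>Fourier coefficients\<close>

text \<open>
  Completing the square. The choice of \<open>c\<close> enters only through the last, nonnegative sum, so the
  Fourier coefficients give the best approximation: \<open>c\<close> equal to them yields Bessel's inequality, and
  dropping that sum for arbitrary \<open>c\<close> yields the Parseval bound.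
\<close>

lemma l2_norm_diff_sum:
  assumes f: "square_integrable P f" and A: "finite A"
  shows "(l2_norm P (\<lambda>\<omega>. f \<omega> - (\<Sum>\<sigma>\<in>A. c \<sigma> * Z M \<sigma> \<omega>)))\<^sup>2 =
    (l2_norm P f)\<^sup>2 - (\<Sum>\<sigma>\<in>A. (cmod (l2_inner P (Z M \<sigma>) f))\<^sup>2)
      + (\<Sum>\<sigma>\<in>A. (cmod (l2_inner P (Z M \<sigma>) f - c \<sigma>))\<^sup>2)"
proof -
  define s where "s = (\<lambda>\<omega>. \<Sum>\<sigma>\<in>A. c \<sigma> * Z M \<sigma> \<omega>)"
  let ?a = "\<lambda>\<sigma>. l2_inner P (Z M \<sigma>) f"
  have s: "square_integrable P s"
    unfolding s_def by (intro square_integrable_sum square_integrable_cmult square_integrable_Z)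
  have inner_s: "l2_inner P g s = (\<Sum>\<sigma>\<in>A. c \<sigma> * l2_inner P g (Z M \<sigma>))"
    if "square_integrable P g" for g
    unfolding s_def by (intro l2_inner_sum_right that square_integrable_Z)
  have fs: "l2_inner P f s = (\<Sum>\<sigma>\<in>A. c \<sigma> * cnj (?a \<sigma>))"
    unfolding inner_s[OF f] by (intro sum.cong refl arg_cong[where f = "(*) _"] l2_inner_commute)
  have Zs: "l2_inner P (Z M \<sigma>) s = c \<sigma>" if "\<sigma> \<in> A" for \<sigma>
    using A that by (simp add: inner_s[OF square_integrable_Z] l2_inner_Z if_distrib cong: if_cong)
  have ss: "l2_inner P s s = (\<Sum>\<sigma>\<in>A. c \<sigma> * cnj (c \<sigma>))"
  proof -
    have "l2_inner P s (Z M \<sigma>) = cnj (c \<sigma>)" if "\<sigma> \<in> A" for \<sigma>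
      unfolding Zs[OF that, symmetric] by (rule l2_inner_commute)
    then show ?thesis
      by (simp add: inner_s[OF s])
  qed
  have fs_s: "square_integrable P (\<lambda>\<omega>. f \<omega> - s \<omega>)"
    by (intro square_integrable_diff f s)
  have "l2_inner P (\<lambda>\<omega>. f \<omega> - s \<omega>) (\<lambda>\<omega>. f \<omega> - s \<omega>)
      = cnj (l2_inner P f (\<lambda>\<omega>. f \<omega> - s \<omega>)) - cnj (l2_inner P s (\<lambda>\<omega>. f \<omega> - s \<omega>))"
    unfolding l2_inner_diff_right[OF fs_s f s]
    by (intro arg_cong2[where f = "(-)"] l2_inner_commute)
  also have "\<dots> = cnj (l2_inner P f f) - cnj (l2_inner P f s) - l2_inner P f s + cnj (l2_inner P s s)"
    by (simp add: l2_inner_diff_right f s l2_inner_commute[of P s f])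
  also have "\<dots> = of_real ((l2_norm P f)\<^sup>2)
      + (\<Sum>\<sigma>\<in>A. cnj (c \<sigma>) * c \<sigma> - cnj (c \<sigma>) * ?a \<sigma> - c \<sigma> * cnj (?a \<sigma>))"
    unfolding ss fs by (simp add: l2_inner_self sum_subtractf sum.distrib algebra_simps)
  also have "\<dots> = of_real ((l2_norm P f)\<^sup>2
      + (\<Sum>\<sigma>\<in>A. (cmod (?a \<sigma> - c \<sigma>))\<^sup>2 - (cmod (?a \<sigma>))\<^sup>2))"
    unfolding of_real_add of_real_sum of_real_diff complex_norm_square
    by (simp add: algebra_simps)
  finally have "(l2_norm P (\<lambda>\<omega>. f \<omega> - s \<omega>))\<^sup>2
      = (l2_norm P f)\<^sup>2 + (\<Sum>\<sigma>\<in>A. (cmod (?a \<sigma> - c \<sigma>))\<^sup>2 - (cmod (?a \<sigma>))\<^sup>2)"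
    unfolding l2_inner_self of_real_eq_iff .
  then show ?thesis
    by (simp add: s_def sum_subtractf)
qed

lemma Bessel_inequality:
  assumes "square_integrable P f" "finite A"
  shows "(\<Sum>\<sigma>\<in>A. (cmod (l2_inner P (Z M \<sigma>) f))\<^sup>2) \<le> (l2_norm P f)\<^sup>2"
  using l2_norm_diff_sum[OF assms, of "\<lambda>\<sigma>. l2_inner P (Z M \<sigma>) f"]
    zero_le_power2[of "l2_norm P (\<lambda>\<omega>. f \<omega> - (\<Sum>\<sigma>\<in>A. l2_inner P (Z M \<sigma>) f * Z M \<sigma> \<omega>))"]
  by simp

lemma summable_coefficients:
  assumes "square_integrable P f"
  shows "(\<lambda>\<sigma>. (cmod (l2_inner P (Z M \<sigma>) f))\<^sup>2) summable_on UNIV"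
proof (rule nonneg_bdd_above_summable_on)
  show "bdd_above (sum (\<lambda>\<sigma>. (cmod (l2_inner P (Z M \<sigma>) f))\<^sup>2) ` {A. A \<subseteq> UNIV \<and> finite A})"
    using Bessel_inequality[OF assms] by (intro bdd_aboveI[of _ "(l2_norm P f)\<^sup>2"]) auto
qed simp

text \<open>
  The half of Parseval's identity that needs totality: an approximation within \<open>sqrt e\<close> by any linear
  combination over \<open>A\<close> leaves at most \<open>e\<close> of \<open>\<parallel>f\<parallel>\<^sup>2\<close> outside the Fourier coefficients over \<open>A\<close>.
\<close>

lemma l2_norm_le_coefficients:
  assumes chaos: "chaotic_representation P M" and f: "f \<in> L2 P M"
  shows "(l2_norm P f)\<^sup>2 \<le> (\<Sum>\<^sub>\<infinity>\<sigma>. (cmod (l2_inner P (Z M \<sigma>) f))\<^sup>2)"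
proof (rule field_le_epsilon)
  fix e :: real
  assume e: "0 < e"
  let ?a = "\<lambda>\<sigma>. (cmod (l2_inner P (Z M \<sigma>) f))\<^sup>2"
  note sq = L2_square_integrable[OF f]
  obtain A c where A: "finite A"
    and less: "l2_norm P (\<lambda>\<omega>. f \<omega> - (\<Sum>\<sigma>\<in>A. c \<sigma> * Z M \<sigma> \<omega>)) < sqrt e"
    using chaos f e unfolding chaotic_representation_def by (meson real_sqrt_gt_0_iff)
  have "(l2_norm P (\<lambda>\<omega>. f \<omega> - (\<Sum>\<sigma>\<in>A. c \<sigma> * Z M \<sigma> \<omega>)))\<^sup>2 \<le> (sqrt e)\<^sup>2"
    using less by (intro power_mono) auto
  moreover have "0 \<le> (\<Sum>\<sigma>\<in>A. (cmod (l2_inner P (Z M \<sigma>) f - c \<sigma>))\<^sup>2)"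
    by (intro sum_nonneg) simp
  ultimately have "(l2_norm P f)\<^sup>2 \<le> sum ?a A + e"
    using l2_norm_diff_sum[OF sq A, of c] e by simp
  also have "sum ?a A \<le> infsum ?a UNIV"
    by (intro finite_sum_le_infsum summable_coefficients sq A) auto
  finally show "(l2_norm P f)\<^sup>2 \<le> infsum ?a UNIV + e"
    by simp
qed

lemma AE_eq_of_coefficients:
  assumes chaos: "chaotic_representation P M" and f: "f \<in> L2 P M" and g: "g \<in> L2 P M"
    and eq: "\<And>\<sigma>. l2_inner P (Z M \<sigma>) f = l2_inner P (Z M \<sigma>) g"
  shows "AE \<omega> in P. f \<omega> = g \<omega>"
proof -
  let ?d = "\<lambda>\<omega>. f \<omega> - g \<omega>"
  have d: "?d \<in> L2 P M"
    by (rule L2_diff[OF f g])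
  have "l2_inner P (Z M \<sigma>) ?d = 0" for \<sigma>
    by (simp add: l2_inner_diff_right square_integrable_Z L2_square_integrable f g eq)
  then have "(l2_norm P ?d)\<^sup>2 \<le> 0"
    using l2_norm_le_coefficients[OF chaos d] by simp
  then have "(LINT \<omega>|P. (cmod (?d \<omega>))\<^sup>2) = 0"
    by (simp add: l2_norm_square[symmetric])
  moreover have "integrable P (\<lambda>\<omega>. (cmod (?d \<omega>))\<^sup>2)"
    using d by (simp add: L2_def)
  ultimately have "AE \<omega> in P. (cmod (?d \<omega>))\<^sup>2 = 0"
    by (subst (asm) integral_nonneg_eq_0_iff_AE) auto
  then show ?thesis
    by simp
qed

section \<open>Synthesis from absolutely summable coefficients\<close>

text \<open>
  Since \<open>\<Sum> |a\<^sub>\<sigma>| |Z\<^sub>\<sigma>|\<^sup>2\<close> has expectation \<open>\<Sum> |a\<^sub>\<sigma>|\<close>, it is finite almost surely. It controls both the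
  absolute convergence of \<open>\<eta> = \<Sum> a\<^sub>\<sigma> Z\<^sub>\<sigma>\<close>, by \<open>|z| \<le> 1 + |z|\<^sup>2\<close>, and the size of the sum, by
  \<open>(\<Sum> |a\<^sub>\<sigma>| |Z\<^sub>\<sigma>|)\<^sup>2 \<le> (\<Sum> |a\<^sub>\<sigma>|) (\<Sum> |a\<^sub>\<sigma>| |Z\<^sub>\<sigma>|\<^sup>2)\<close>. The coefficients of \<open>\<eta>\<close> are then read off by
  integrating the series term by term.
\<close>

lemma exists_L2_with_coefficients:
  assumes a: "(\<lambda>\<sigma>. cmod (a \<sigma>)) summable_on UNIV"
  shows "\<exists>\<eta>\<in>L2 P M. \<forall>\<sigma>. l2_inner P (Z M \<sigma>) \<eta> = a \<sigma>"
proof -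
  have "inj (\<lambda>n::nat. {|n|})"
    by (simp add: inj_on_def)
  then have "infinite (UNIV :: nat fset set)"
    using finite_imageD[of "\<lambda>n::nat. {|n|}" UNIV] finite_subset[OF subset_UNIV] by blast
  then obtain e :: "nat \<Rightarrow> nat fset" where e: "bij e"
    using bij_betw_from_nat_into[of "UNIV :: nat fset set"] by auto
  define b where "b = (\<lambda>n. a (e n))"
  define z where "z = (\<lambda>n. Z M (e n))"
  define B where "B = (\<Sum>n. cmod (b n))"
  have "(\<lambda>n. cmod (a (e n))) summable_on UNIV"
    using a summable_on_reindex_bij_betw[OF e, of "\<lambda>\<sigma>. cmod (a \<sigma>)"] by simp
  then have sb: "summable (\<lambda>n. cmod (b n))"
    unfolding b_def by (rule summable_on_imp_summable)
  have sq_z: "square_integrable P (z n)" for n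
    by (simp add: z_def square_integrable_Z)
  have z_measurable: "z n \<in> borel_measurable (sigma_of P M UNIV)" for n
    using Z_in_L2[of "e n"] by (simp add: z_def L2_def)
  have [measurable]: "z n \<in> borel_measurable P" for n
    by (rule square_integrable_measurable[OF sq_z])
  have int_Z: "integrable P (\<lambda>\<omega>. (cmod (Z M \<sigma> \<omega>))\<^sup>2)" and norm_Z: "(LINT \<omega>|P. (cmod (Z M \<sigma> \<omega>))\<^sup>2) = 1" for \<sigma>
    using square_integrable_Z[of \<sigma>] l2_inner_self[of P "Z M \<sigma>"] l2_inner_Z[of \<sigma> \<sigma>]
    unfolding l2_norm_square[symmetric] square_integrable_def
    by (simp_all del: of_real_power add: of_real_eq_1_iff)
  \<comment> \<open>The dominating series of the proof; a finite expectation makes it finite almost surely.\<close>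
  define w where "w = (\<lambda>n \<omega>. cmod (b n) * (cmod (z n \<omega>))\<^sup>2)"
  have w_nonneg: "0 \<le> w n \<omega>" for n \<omega>
    by (simp add: w_def)
  have int_w: "integrable P (w n)" and integral_w: "(LINT \<omega>|P. w n \<omega>) = cmod (b n)" for n
    using int_Z[of "e n"] norm_Z[of "e n"] by (simp_all add: w_def z_def)
  have summable_w: "AE \<omega> in P. summable (\<lambda>n. w n \<omega>)"
  proof -
    have [measurable]: "w n \<in> borel_measurable P" for n
      using int_w by auto
    have "(\<integral>\<^sup>+\<omega>. (\<Sum>n. ennreal (w n \<omega>)) \<partial>P) = (\<Sum>n. \<integral>\<^sup>+\<omega>. ennreal (w n \<omega>) \<partial>P)"
      by (rule nn_integral_suminf) measurable
    also have "\<dots> = (\<Sum>n. ennreal (cmod (b n)))"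
      by (simp add: nn_integral_eq_integral[OF int_w] w_nonneg integral_w)
    also have "\<dots> = ennreal B"
      unfolding B_def by (intro suminf_ennreal2 sb) simp
    finally have "AE \<omega> in P. (\<Sum>n. ennreal (w n \<omega>)) \<noteq> \<infinity>"
      by (intro nn_integral_PInf_AE) auto
    then show ?thesis
      by eventually_elim (auto intro!: summable_suminf_not_top w_nonneg)
  qed
  have int_sum_w: "integrable P (\<lambda>\<omega>. \<Sum>n. w n \<omega>)"
    using summable_w sb w_nonneg by (intro integrable_suminf int_w) (simp_all add: integral_w)
  have summable_bz: "summable (\<lambda>n. cmod (b n * z n \<omega>))" if "summable (\<lambda>n. w n \<omega>)" for \<omega>
  proof (rule summable_comparison_test'[where N = 0])
    show "summable (\<lambda>n. cmod (b n) + w n \<omega>)"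
      by (intro summable_add sb that)
    show "norm (cmod (b n * z n \<omega>)) \<le> cmod (b n) + w n \<omega>" for n
    proof -
      have "cmod (z n \<omega>) \<le> 1 + (cmod (z n \<omega>))\<^sup>2"
        using sum_squares_bound[of 1 "cmod (z n \<omega>)"] norm_ge_zero[of "z n \<omega>"]
        by (simp; linarith)
      then show ?thesis
        using mult_left_mono[of "cmod (z n \<omega>)" "1 + (cmod (z n \<omega>))\<^sup>2" "cmod (b n)"]
        by (simp add: w_def norm_mult distrib_left)
    qed
  qed
  define \<eta> where "\<eta> = (\<lambda>\<omega>. \<Sum>n. b n * z n \<omega>)"
  have \<eta>_measurable: "\<eta> \<in> borel_measurable (sigma_of P M UNIV)"
    unfolding \<eta>_def using z_measurable by (intro borel_measurable_suminf) auto
  have [measurable]: "\<eta> \<in> borel_measurable P"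
    by (rule measurable_sigma_of_imp[OF \<eta>_measurable])
  have \<eta>_bound: "(cmod (\<eta> \<omega>))\<^sup>2 \<le> B * (\<Sum>n. w n \<omega>)" if "summable (\<lambda>n. w n \<omega>)" for \<omega>
  proof -
    have "cmod (\<eta> \<omega>) \<le> (\<Sum>n. cmod (b n * z n \<omega>))"
      unfolding \<eta>_def by (rule summable_norm[OF summable_bz[OF that]])
    also have "\<dots> \<le> sqrt (B * (\<Sum>n. w n \<omega>))"
    proof (rule suminf_le_const[OF summable_bz[OF that]])
      fix N
      \<comment> \<open>Half of each weight goes to either factor of the Cauchy-Schwarz inequality.\<close>
      have "(\<Sum>n<N. cmod (b n * z n \<omega>))\<^sup>2
          = (\<Sum>n<N. sqrt (cmod (b n)) * (sqrt (cmod (b n)) * cmod (z n \<omega>)))\<^sup>2"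
        by (simp add: norm_mult mult.assoc[symmetric])
      also have "\<dots> \<le> (\<Sum>n<N. (sqrt (cmod (b n)))\<^sup>2) * (\<Sum>n<N. (sqrt (cmod (b n)) * cmod (z n \<omega>))\<^sup>2)"
        by (rule Cauchy_Schwarz_ineq_sum)
      also have "\<dots> = (\<Sum>n<N. cmod (b n)) * (\<Sum>n<N. w n \<omega>)"
        by (simp add: w_def power_mult_distrib)
      also have "\<dots> \<le> B * (\<Sum>n. w n \<omega>)"
        unfolding B_def
        by (intro mult_mono sum_le_suminf sb that sum_nonneg suminf_nonneg) (auto simp: w_nonneg)
      finally show "(\<Sum>n<N. cmod (b n * z n \<omega>)) \<le> sqrt (B * (\<Sum>n. w n \<omega>))"
        by (rule real_le_rsqrt)
    qed
    finally have "(cmod (\<eta> \<omega>))\<^sup>2 \<le> (sqrt (B * (\<Sum>n. w n \<omega>)))\<^sup>2"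
      by (rule power_mono) simp
    also have "\<dots> = B * (\<Sum>n. w n \<omega>)"
      unfolding B_def
      by (intro real_sqrt_pow2 mult_nonneg_nonneg suminf_nonneg sb that) (auto simp: w_nonneg)
    finally show ?thesis .
  qed
  have "integrable P (\<lambda>\<omega>. (cmod (\<eta> \<omega>))\<^sup>2)"
  proof (rule Bochner_Integration.integrable_bound)
    show "integrable P (\<lambda>\<omega>. B * (\<Sum>n. w n \<omega>))"
      using int_sum_w by simp
    show "AE \<omega> in P. norm ((cmod (\<eta> \<omega>))\<^sup>2) \<le> norm (B * (\<Sum>n. w n \<omega>))"
      using summable_w by eventually_elim (use \<eta>_bound in fastforce)
  qed measurable
  then have \<eta>_L2: "\<eta> \<in> L2 P M"
    using \<eta>_measurable by (simp add: L2_def)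
  have "l2_inner P (Z M \<tau>) \<eta> = a \<tau>" for \<tau>
  proof -
    define u where "u = (\<lambda>n \<omega>. cnj (Z M \<tau> \<omega>) * (b n * z n \<omega>))"
    have int_u: "integrable P (u n)" for n
      unfolding u_def by (intro integrable_cnj_mult square_integrable_Z square_integrable_cmult sq_z)
    have u_sum: "(\<Sum>n. u n \<omega>) = cnj (Z M \<tau> \<omega>) * \<eta> \<omega>" "summable (\<lambda>n. norm (u n \<omega>))"
      if "summable (\<lambda>n. w n \<omega>)" for \<omega>
      using summable_bz[OF that] unfolding u_def \<eta>_def
      by (auto simp: norm_mult[of "cnj _"] intro: suminf_mult summable_norm_cancel summable_mult)
    have u_norm: "(LINT \<omega>|P. norm (u n \<omega>)) \<le> cmod (b n) * 2" for n
    proof -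
      have "(LINT \<omega>|P. norm (u n \<omega>))
          \<le> (LINT \<omega>|P. cmod (b n) * ((cmod (Z M \<tau> \<omega>))\<^sup>2 + (cmod (z n \<omega>))\<^sup>2))"
      proof (rule integral_mono)
        show "integrable P (\<lambda>\<omega>. cmod (b n) * ((cmod (Z M \<tau> \<omega>))\<^sup>2 + (cmod (z n \<omega>))\<^sup>2))"
          using int_Z[of \<tau>] int_Z[of "e n"] by (simp add: z_def)
        fix \<omega>
        have "0 \<le> cmod (Z M \<tau> \<omega>) * cmod (z n \<omega>)"
          by simp
        then have "cmod (Z M \<tau> \<omega>) * cmod (z n \<omega>) \<le> (cmod (Z M \<tau> \<omega>))\<^sup>2 + (cmod (z n \<omega>))\<^sup>2"
          using sum_squares_bound[of "cmod (Z M \<tau> \<omega>)" "cmod (z n \<omega>)"] by linarith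
        from mult_left_mono[OF this, of "cmod (b n)"]
        show "norm (u n \<omega>) \<le> cmod (b n) * ((cmod (Z M \<tau> \<omega>))\<^sup>2 + (cmod (z n \<omega>))\<^sup>2)"
          by (simp add: u_def norm_mult mult.left_commute)
      qed (use int_u in auto)
      also have "\<dots> = cmod (b n) * 2"
        using int_Z[of \<tau>] int_Z[of "e n"] norm_Z[of \<tau>] norm_Z[of "e n"] by (simp add: z_def)
      finally show ?thesis .
    qed
    have summable_u: "summable (\<lambda>n. LINT \<omega>|P. norm (u n \<omega>))"
      by (rule summable_comparison_test'[where N = 0 and g = "\<lambda>n. cmod (b n) * 2"])
         (use sb u_norm in \<open>auto intro: summable_mult2 simp: integral_nonneg_AE\<close>)
    have "l2_inner P (Z M \<tau>) \<eta> = (LINT \<omega>|P. (\<Sum>n. u n \<omega>))"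
      unfolding l2_inner_def
    proof (rule integral_cong_AE)
      show "(\<lambda>\<omega>. \<Sum>n. u n \<omega>) \<in> borel_measurable P"
        using int_u by (intro borel_measurable_suminf) auto
      show "(\<lambda>\<omega>. cnj (Z M \<tau> \<omega>) * \<eta> \<omega>) \<in> borel_measurable P"
        using integrable_cnj_mult[OF square_integrable_Z L2_square_integrable[OF \<eta>_L2]] by auto
      show "AE \<omega> in P. cnj (Z M \<tau> \<omega>) * \<eta> \<omega> = (\<Sum>n. u n \<omega>)"
        using summable_w by eventually_elim (simp add: u_sum)
    qed
    also have "\<dots> = (\<Sum>n. LINT \<omega>|P. u n \<omega>)"
      by (rule integral_suminf[OF int_u _ summable_u])
         (use summable_w in \<open>eventually_elim; simp add: u_sum\<close>)
    also have "\<dots> = (\<Sum>n. b n * (if \<tau> = e n then 1 else 0))"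
    proof (intro suminf_cong)
      fix n
      have "(LINT \<omega>|P. u n \<omega>) = l2_inner P (Z M \<tau>) (\<lambda>\<omega>. b n * z n \<omega>)"
        by (simp add: u_def l2_inner_def)
      then show "(LINT \<omega>|P. u n \<omega>) = b n * (if \<tau> = e n then 1 else 0)"
        by (simp add: l2_inner_cmult_right z_def l2_inner_Z)
    qed
    also have "\<dots> = (\<Sum>n\<in>{inv e \<tau>}. b n * (if \<tau> = e n then 1 else 0))"
      using e by (intro suminf_finite) (auto simp: bij_is_inj)
    also have "\<dots> = a \<tau>"
      using e by (simp add: b_def bij_is_surj surj_f_inv_f)
    finally show ?thesis .
  qed
  with \<eta>_L2 show ?thesis
    by blast
qed

section \<open>Testing functionals\<close>

lemma testing_L2: "\<xi> \<in> testing P M \<Longrightarrow> \<xi> \<in> L2 P M"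
  by (simp add: testing_def S_p_def)

lemma testing_square_integrable: "\<xi> \<in> testing P M \<Longrightarrow> square_integrable P \<xi>"
  by (intro L2_square_integrable testing_L2)

lemma l2_norm_le_pnorm_0:
  assumes "chaotic_representation P M" and "f \<in> L2 P M"
  shows "l2_norm P f \<le> pnorm P M 0 f"
proof -
  have "lam \<sigma> \<noteq> 0" for \<sigma>
    using lam_pos[of \<sigma>] by simp
  then show ?thesis
    using l2_norm_le_coefficients[OF assms] by (simp add: pnorm_def real_le_rsqrt)
qed

text \<open>
  A single norm of the family, the one with \<open>p = 0\<close>, suffices for the continuity of \<open>Phi P \<eta>\<close>.
\<close>

lemma Phi_diff_le:
  assumes chaos: "chaotic_representation P M"
    and \<eta>: "\<eta> \<in> testing P M" and \<xi>: "\<xi> \<in> testing P M" and \<zeta>: "\<zeta> \<in> testing P M"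
  shows "dist (Phi P \<eta> \<xi>) (Phi P \<eta> \<zeta>) \<le> l2_norm P \<eta> * pnorm P M 0 (\<lambda>\<omega>. \<xi> \<omega> - \<zeta> \<omega>)"
proof -
  let ?d = "\<lambda>\<omega>. \<xi> \<omega> - \<zeta> \<omega>"
  have d: "?d \<in> L2 P M"
    by (intro L2_diff testing_L2 \<xi> \<zeta>)
  have "dist (Phi P \<eta> \<xi>) (Phi P \<eta> \<zeta>) = cmod (l2_inner P \<eta> ?d)"
    by (simp add: Phi_def dist_norm l2_inner_diff_right testing_square_integrable \<eta> \<xi> \<zeta>)
  also have "\<dots> \<le> l2_norm P \<eta> * l2_norm P ?d"
    by (intro l2_Cauchy_Schwarz testing_square_integrable \<eta> L2_square_integrable d)
  also have "\<dots> \<le> l2_norm P \<eta> * pnorm P M 0 ?d"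
    by (intro mult_left_mono l2_norm_le_pnorm_0 chaos d) simp
  finally show ?thesis .
qed

lemma pnorm_diff_self: "pnorm P M p (\<lambda>\<omega>. \<xi> \<omega> - \<xi> \<omega>) = 0"
  by (simp add: pnorm_def l2_inner_def)

lemma openin_testing_ball:
  assumes "0 \<le> p" "\<zeta> \<in> testing P M" "0 < r"
  shows "openin (testing_topology P M) {\<xi> \<in> testing P M. pnorm P M p (\<lambda>\<omega>. \<xi> \<omega> - \<zeta> \<omega>) < r}"
  unfolding testing_topology_def using assms by (intro topology_generated_by_Basis) blast

lemma topspace_testing_topology: "topspace (testing_topology P M) = testing P M"
proof
  show "topspace (testing_topology P M) \<subseteq> testing P M"
    unfolding testing_topology_def topology_generated_by_topspace by blast
  show "testing P M \<subseteq> topspace (testing_topology P M)"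
  proof
    fix \<xi>
    assume "\<xi> \<in> testing P M"
    then show "\<xi> \<in> topspace (testing_topology P M)"
      using openin_subset[OF openin_testing_ball[of 0 \<xi> 1]] pnorm_diff_self[of 0 \<xi>] by auto
  qed
qed

lemma continuous_map_Phi:
  assumes chaos: "chaotic_representation P M" and \<eta>: "\<eta> \<in> testing P M"
  shows "continuous_map (testing_topology P M) euclidean (Phi P \<eta>)"
  unfolding continuous_map_def topspace_testing_topology
proof (intro conjI allI impI)
  fix U :: "complex set"
  assume "openin euclidean U"
  then have U: "open U"
    by simp
  show "openin (testing_topology P M) {\<xi> \<in> testing P M. Phi P \<eta> \<xi> \<in> U}"
    unfolding openin_subopen[of _ "{\<xi> \<in> testing P M. Phi P \<eta> \<xi> \<in> U}"]
  proof
    fix \<zeta>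
    assume "\<zeta> \<in> {\<xi> \<in> testing P M. Phi P \<eta> \<xi> \<in> U}"
    then have \<zeta>: "\<zeta> \<in> testing P M" and "Phi P \<eta> \<zeta> \<in> U"
      by auto
    then obtain e where e: "0 < e" and ball: "\<And>y. dist y (Phi P \<eta> \<zeta>) < e \<Longrightarrow> y \<in> U"
      using U unfolding open_dist by blast
    \<comment> \<open>The summand 1 keeps the radius meaningful when \<eta> has norm zero.\<close>
    define r where "r = e / (l2_norm P \<eta> + 1)"
    have pos: "0 < l2_norm P \<eta> + 1"
      by (simp add: add_nonneg_pos)
    have r: "0 < r"
      using e pos by (simp add: r_def)
    let ?T = "{\<xi> \<in> testing P M. pnorm P M 0 (\<lambda>\<omega>. \<xi> \<omega> - \<zeta> \<omega>) < r}"
    have "?T \<subseteq> {\<xi> \<in> testing P M. Phi P \<eta> \<xi> \<in> U}"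
    proof clarify
      fix \<xi>
      assume \<xi>: "\<xi> \<in> testing P M" and less: "pnorm P M 0 (\<lambda>\<omega>. \<xi> \<omega> - \<zeta> \<omega>) < r"
      have "dist (Phi P \<eta> \<xi>) (Phi P \<eta> \<zeta>) \<le> l2_norm P \<eta> * pnorm P M 0 (\<lambda>\<omega>. \<xi> \<omega> - \<zeta> \<omega>)"
        by (rule Phi_diff_le[OF chaos \<eta> \<xi> \<zeta>])
      also have "\<dots> \<le> l2_norm P \<eta> * r"
        using less by (intro mult_left_mono) auto
      also have "\<dots> < (l2_norm P \<eta> + 1) * r"
        using r by (simp add: distrib_right)
      also have "\<dots> = e"
        using pos by (simp add: r_def)
      finally show "Phi P \<eta> \<xi> \<in> U"
        by (rule ball)
    qed
    moreover have "\<zeta> \<in> ?T"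
      using \<zeta> r pnorm_diff_self[of 0 \<zeta>] by simp
    ultimately show "\<exists>T. openin (testing_topology P M) T \<and> \<zeta> \<in> T \<and>
        T \<subseteq> {\<xi> \<in> testing P M. Phi P \<eta> \<xi> \<in> U}"
      using openin_testing_ball[OF order_refl \<zeta> r] by blast
  qed
qed simp

lemma Phi_generalized:
  assumes "chaotic_representation P M" and "\<eta> \<in> testing P M"
  shows "Phi P \<eta> \<in> generalized P M"
  unfolding generalized_def
  using continuous_map_Phi[OF assms] assms(2)
  by (auto simp: Phi_def l2_inner_cmult_right l2_inner_add_right testing_square_integrable)

section \<open>Fock transforms of testing functionals\<close>

lemma fock_transform_Phi: "fock_transform M (Phi P \<eta>) \<sigma> = cnj (l2_inner P (Z M \<sigma>) \<eta>)"
  unfolding fock_transform_def Phi_def by (rule l2_inner_commute)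

lemma fock_transform_decay:
  assumes \<eta>: "\<eta> \<in> testing P M"
  shows "\<exists>C\<ge>0. \<forall>\<sigma>. cmod (fock_transform M (Phi P \<eta>) \<sigma>) \<le> C * lam \<sigma> powr (- p)"
proof -
  \<comment> \<open>Testing functionals are defined by natural orders only; a real order is dominated by one.\<close>
  obtain n :: nat where n: "p \<le> real n"
    using real_arch_simple by blast
  let ?s = "\<lambda>\<sigma>. lam \<sigma> powr (2 * real n) * (cmod (l2_inner P (Z M \<sigma>) \<eta>))\<^sup>2"
  have sum: "?s summable_on UNIV"
    using \<eta> by (auto simp: testing_def S_p_def)
  have bound: "cmod (fock_transform M (Phi P \<eta>) \<sigma>) \<le> sqrt (infsum ?s UNIV) * lam \<sigma> powr (- p)" for \<sigma>
  proof -
    let ?a = "cmod (l2_inner P (Z M \<sigma>) \<eta>)"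
    have "(lam \<sigma> powr real n * ?a)\<^sup>2 = ?s \<sigma>"
      by (simp add: power_mult_distrib power2_eq_square flip: powr_add)
    also have "\<dots> \<le> infsum ?s UNIV"
      using finite_sum_le_infsum[OF sum, of "{\<sigma>}"] by simp
    finally have "lam \<sigma> powr real n * ?a \<le> sqrt (infsum ?s UNIV)"
      by (rule real_le_rsqrt)
    moreover have "lam \<sigma> powr p * ?a \<le> lam \<sigma> powr real n * ?a"
      using n lam_ge_1[of \<sigma>] by (intro mult_right_mono powr_mono) auto
    ultimately have "lam \<sigma> powr p * ?a \<le> sqrt (infsum ?s UNIV)"
      by simp
    then show ?thesis
      using lam_pos[of \<sigma>] by (simp add: fock_transform_Phi powr_minus field_simps)
  qed
  show ?thesis
    by (rule exI[of _ "sqrt (infsum ?s UNIV)"]) (use bound in \<open>auto intro!: infsum_nonneg\<close>)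
qed

text \<open>
  Decay of order \<open>2\<close> produces the functional. Decay of order \<open>p + 1\<close> bounds the terms of the squared
  \<open>p\<close>-norm by a multiple of \<open>\<lambda>\<^sub>\<sigma>\<^sup>-\<^sup>2\<close>, so that norm is finite. The conjugate appears
  because \<open>Phi P \<eta>\<close> is conjugate-linear in \<open>\<eta>\<close>.
\<close>

lemma exists_testing_with_fock_transform:
  assumes decay: "\<forall>p::real\<ge>0. \<exists>C::real\<ge>0. \<forall>\<sigma>. cmod (F \<sigma>) \<le> C * lam \<sigma> powr (- p)"
  shows "\<exists>\<eta>\<in>testing P M. fock_transform M (Phi P \<eta>) = F"
proof -
  obtain C where C: "\<And>\<sigma>. cmod (F \<sigma>) \<le> C * lam \<sigma> powr (- 2)"
    using decay[rule_format, of 2] by auto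
  have "(\<lambda>\<sigma>. cmod (cnj (F \<sigma>))) summable_on UNIV"
    using C by (intro summable_on_comparison_test[OF summable_on_cmult_right[OF summable_lam, of C]]) auto
  from exists_L2_with_coefficients[OF this]
  obtain \<eta> where \<eta>: "\<eta> \<in> L2 P M" and coeff: "\<And>\<sigma>. l2_inner P (Z M \<sigma>) \<eta> = cnj (F \<sigma>)"
    by blast
  have "\<eta> \<in> S_p P M (real p)" for p
  proof -
    obtain K where K: "0 \<le> K" "\<And>\<sigma>. cmod (F \<sigma>) \<le> K * lam \<sigma> powr (- (real p + 1))"
      using decay[rule_format, of "real p + 1"] by auto
    have "lam \<sigma> powr (2 * real p) * (cmod (F \<sigma>))\<^sup>2 \<le> K\<^sup>2 * lam \<sigma> powr (- 2)" for \<sigma>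
    proof -
      have "(cmod (F \<sigma>))\<^sup>2 \<le> (K * lam \<sigma> powr (- (real p + 1)))\<^sup>2"
        using K(2) by (intro power_mono) auto
      also have "\<dots> = K\<^sup>2 * lam \<sigma> powr (- 2 * real p - 2)"
        by (simp add: power_mult_distrib power2_eq_square flip: powr_add)
      finally have "lam \<sigma> powr (2 * real p) * (cmod (F \<sigma>))\<^sup>2
          \<le> lam \<sigma> powr (2 * real p) * (K\<^sup>2 * lam \<sigma> powr (- 2 * real p - 2))"
        by (intro mult_left_mono) auto
      also have "\<dots> = K\<^sup>2 * lam \<sigma> powr (- 2)"
        by (simp add: mult.left_commute flip: powr_add)
      finally show ?thesis .
    qed
    then have "(\<lambda>\<sigma>. lam \<sigma> powr (2 * real p) * (cmod (F \<sigma>))\<^sup>2) summable_on UNIV"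
      by (intro summable_on_comparison_test[OF summable_on_cmult_right[OF summable_lam, of "K\<^sup>2"]]) auto
    then show ?thesis
      using \<eta> by (simp add: S_p_def coeff)
  qed
  then have "\<eta> \<in> testing P M"
    by (simp add: testing_def)
  moreover have "fock_transform M (Phi P \<eta>) = F"
    by (rule ext) (simp add: fock_transform_Phi coeff)
  ultimately show ?thesis
    by blast
qed

lemma fock_transform_Phi_unique:
  assumes chaos: "chaotic_representation P M"
    and "\<eta> \<in> testing P M" "\<eta>' \<in> testing P M"
    and eq: "fock_transform M (Phi P \<eta>') = fock_transform M (Phi P \<eta>)"
  shows "AE \<omega> in P. \<eta>' \<omega> = \<eta> \<omega>"
proof (rule AE_eq_of_coefficients[OF chaos])
  show "l2_inner P (Z M \<sigma>) \<eta>' = l2_inner P (Z M \<sigma>) \<eta>" for \<sigma>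
    using fun_cong[OF eq, of \<sigma>] by (simp add: fock_transform_Phi)
qed (intro testing_L2 assms)+

end

theorem theorem4p5:
  fixes P :: "'a measure" and M :: "nat \<Rightarrow> 'a \<Rightarrow> real" and F :: "nat fset \<Rightarrow> complex"
  assumes "prob_space P"
    and "normal_martingale P M"
    and "chaotic_representation P M"
  shows "(\<forall>\<eta>\<in>testing P M. Phi P \<eta> \<in> generalized P M) \<and>
    ((\<forall>p::real\<ge>0. \<exists>C::real\<ge>0. \<forall>\<sigma>. cmod (F \<sigma>) \<le> C * lam \<sigma> powr (- p)) \<longrightarrow>
       (\<exists>\<eta>\<in>testing P M. fock_transform M (Phi P \<eta>) = F \<and>
          (\<forall>\<eta>'\<in>testing P M. fock_transform M (Phi P \<eta>') = F \<longrightarrow>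
             (AE \<omega> in P. \<eta>' \<omega> = \<eta> \<omega>)))) \<and>
    ((\<exists>\<eta>\<in>testing P M. F = fock_transform M (Phi P \<eta>)) \<longrightarrow>
       (\<forall>p::real\<ge>0. \<exists>C::real\<ge>0. \<forall>\<sigma>. cmod (F \<sigma>) \<le> C * lam \<sigma> powr (- p)))"
proof -
  interpret normal_martingale_space P M
    using assms(1,2) by (simp add: normal_martingale_space_def normal_martingale_space_axioms_def)
  show ?thesis
  proof (intro conjI impI)
    show "\<forall>\<eta>\<in>testing P M. Phi P \<eta> \<in> generalized P M"
      using Phi_generalized[OF assms(3)] by blast
  next
    assume "\<forall>p::real\<ge>0. \<exists>C::real\<ge>0. \<forall>\<sigma>. cmod (F \<sigma>) \<le> C * lam \<sigma> powr (- p)"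
    from exists_testing_with_fock_transform[OF this]
    show "\<exists>\<eta>\<in>testing P M. fock_transform M (Phi P \<eta>) = F \<and>
        (\<forall>\<eta>'\<in>testing P M. fock_transform M (Phi P \<eta>') = F \<longrightarrow> (AE \<omega> in P. \<eta>' \<omega> = \<eta> \<omega>))"
      using fock_transform_Phi_unique[OF assms(3)] by blast
  next
    assume "\<exists>\<eta>\<in>testing P M. F = fock_transform M (Phi P \<eta>)"
    then show "\<forall>p::real\<ge>0. \<exists>C::real\<ge>0. \<forall>\<sigma>. cmod (F \<sigma>) \<le> C * lam \<sigma> powr (- p)"
      using fock_transform_decay by blast
  qed
qed

end
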